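(* Let $\mathcal P\in\{\mathcal{SP},\mathcal{HSP}\}$, where $\mathcal{SP}$ is the specification property and $\mathcal{HSP}$ is the Hausdorff specification property of CR-dynamical systems. Then the following hold. (1) $\mathcal P$ is a CR-dynamical property that generalizes the specification property (of dynamical systems). (2) For any dynamical system $(X,f)$, if $(X,f)$ has the specification property, then $(X,f)$ has $\mathrm{Power}(\mathcal P)$.
   Context: A dynamical system is a pair $(X,f)$ where $X$ is a non-empty compact metric space with metric $d$ and $f:X\to X$ is continuous. Two dynamical systems $(X,f)$, $(Y,g)$ are topological conjugates if there is a homeomorphism $\varphi:X\to Y$ with $\varphi\circ f=g\circ\varphi$. A CR-dynamical system is a pair $(X,F)$ where $X$ is a non-empty compact metric space and $F\subseteq X\times X$ is closed in $X\times X$; a dynamical system $(X,f)$ is regarded as a CR-dynamical system by identifying $f$ with its graph. CR-dynamical systems $(X,F)$, $(Y,G)$ are topological conjugates if there is a homeomorphism $\varphi:X\to Y$ with $(x,y)\in F\Leftrightarrow(\varphi(x),\varphi(y))\in G$ for all $(x,y)\in X\times X$. Specification property of a dynamical system $(X,f)$: for each $\varepsilon>0$ there is a positive integer $N$ such that for every positive integer $n$, all points $x_1,\ldots,x_n\in X$ and all integers $0\le k_j\le\ell_j$ ($1\le j\le n$) with $k_{j+1}-\ell_j\ge N$ for $1\le j\le n-1$, there is $y\in X$ with $d(f^j(y),f^j(x_i))\le\varepsilon$ for all $i\in\{1,\ldots,n\}$ and $j\in\{k_i,\ldots,\ell_i\}$. For a CR-dynamical system $(X,F)$: $F(x)=\{y:(x,y)\in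 F\}$, $F(A)=\bigcup_{a\in A}F(a)$, $F^0(x)=\{x\}$, $F^{k+1}(x)=F(F^k(x))$. For non-empty $A,B\subseteq X$, $d(A,B)=\inf\{d(a,b):a\in A,b\in B\}$; $H_d$ is the Hausdorff metric on the set of non-empty closed subsets of $X$. An inequality $d(A,B)\le\varepsilon$ or $H_d(A,B)\le\varepsilon$ is understood to hold only if $A,B$ are non-empty. Write $F^{[k,\ell]}(x)=(F^k(x),\ldots,F^\ell(x))$. A specification in $(X,F)$ is a tuple $\mathcal S=(F^{[k_1,\ell_1]}(x_1),\ldots,F^{[k_n,\ell_n]}(x_n))$ with $n\ge1$, $x_j\in X$, integers $0\le k_j\le\ell_j$ (these data being part of $\mathcal S$); it is $N$-spaced if $k_{j+1}-\ell_j\ge N$ for $1\le j\le n-1$. An $N$-spaced specification $\mathcal S$ is $\varepsilon$-traced (respectively Hausdorff $\varepsilon$-traced) in $(X,F)$ by $y$ if $d(F^j(y),F^j(x_i))\le\varepsilon$ (respectively $H_d(F^j(y),F^j(x_i))\le\varepsilon$) for all $i\in\{1,\ldots,n\}$ and $j\in\{k_i,\ldots,\ell_i\}$. $(X,F)$ has the specification property $\mathcal{SP}$ (respectively the Hausdorff specification property $\mathcal{HSP}$) if for each $\varepsilon>0$ there is a positive integer $N$ such that every $N$-spaced specification in $(X,F)$ is $\varepsilon$-traced (respectively Hausdorff $\varepsilon$-traced) in $(X,F)$ by some $y\in X$. A property $\mathcal P$ of CR-dynamical systems is a CR-dynamical property if it is preserved under topological conjugacy of CR-dynamical systems. It generalizes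 a property $\mathcal R$ of dynamical systems if for each dynamical system $(X,f)$: $(X,f)$ has $\mathcal P$ (as a CR-dynamical system) if and only if $(X,f)$ has $\mathcal R$. For a CR-dynamical system $(Z,F)$, $Z_F^+=\{(x_1,x_2,\ldots)\in\prod_{i=1}^\infty Z:(x_i,x_{i+1})\in F\text{ for all }i\ge1\}$ with the product topology and $\sigma_F^+(x_1,x_2,x_3,\ldots)=(x_2,x_3,\ldots)$. A dynamical system $(X,f)$ has $\mathrm{Power}(\mathcal P)$ (is powered by $\mathcal P$) if there is a CR-dynamical system $(Z,F)$ having property $\mathcal P$ such that $(X,f)$ and $(Z_F^+,\sigma_F^+)$ are topological conjugates. *)

theory Defs
  imports "HOL-Analysis.Analysis"
begin

text \<open>Metric spaces are given by an explicit carrier and metric, as in \<^locale>\<open>Metric_space\<close>;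
  maps and relations matter only on the carrier.\<close>

definition compact_metric :: "'a set \<Rightarrow> ('a \<Rightarrow> 'a \<Rightarrow> real) \<Rightarrow> bool" where
  "compact_metric X d \<longleftrightarrow>
     X \<noteq> {} \<and> Metric_space X d \<and> compact_space (Metric_space.mtopology X d)"

definition dynamical_system :: "'a set \<Rightarrow> ('a \<Rightarrow> 'a \<Rightarrow> real) \<Rightarrow> ('a \<Rightarrow> 'a) \<Rightarrow> bool" where
  "dynamical_system X d f \<longleftrightarrow>
     compact_metric X d \<and>
     continuous_map (Metric_space.mtopology X d) (Metric_space.mtopology X d) f"

definition CR_system :: "'a set \<Rightarrow> ('a \<Rightarrow> 'a \<Rightarrow> real) \<Rightarrow> ('a \<times> 'a) set \<Rightarrow> bool" where
  "CR_system X d F \<longleftrightarrow>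
     compact_metric X d \<and>
     closedin (prod_topology (Metric_space.mtopology X d) (Metric_space.mtopology X d)) F"

definition graph_on :: "'a set \<Rightarrow> ('a \<Rightarrow> 'a) \<Rightarrow> ('a \<times> 'a) set" where
  "graph_on X f = {(x, f x) |x. x \<in> X}"

text \<open>Conjugacy of \<open>f\<close> and \<open>g\<close> only involves the topologies of the two phase spaces.\<close>

definition conjugate ::
  "'a topology \<Rightarrow> ('a \<Rightarrow> 'a) \<Rightarrow> 'b topology \<Rightarrow> ('b \<Rightarrow> 'b) \<Rightarrow> bool" where
  "conjugate T f U g \<longleftrightarrow>
     (\<exists>\<phi>. homeomorphic_map T U \<phi> \<and> (\<forall>x\<in>topspace T. \<phi> (f x) = g (\<phi> x)))"

definition CR_conjugate ::
  "'a set \<Rightarrow> ('a \<Rightarrow> 'a \<Rightarrow> real) \<Rightarrow> ('a \<times> 'a) set \<Rightarrow>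
   'b set \<Rightarrow> ('b \<Rightarrow> 'b \<Rightarrow> real) \<Rightarrow> ('b \<times> 'b) set \<Rightarrow> bool" where
  "CR_conjugate X d F Y e G \<longleftrightarrow>
     (\<exists>\<phi>. homeomorphic_map (Metric_space.mtopology X d) (Metric_space.mtopology Y e) \<phi> \<and>
          (\<forall>x\<in>X. \<forall>y\<in>X. (x, y) \<in> F \<longleftrightarrow> (\<phi> x, \<phi> y) \<in> G))"

primrec iter :: "('a \<times> 'a) set \<Rightarrow> nat \<Rightarrow> 'a \<Rightarrow> 'a set" where
  "iter F 0 x = {x}"
| "iter F (Suc k) x = F `` iter F k x"

text \<open>The two distances below are only meaningful for non-empty arguments.\<close>

definition set_dist :: "('a \<Rightarrow> 'a \<Rightarrow> real) \<Rightarrow> 'a set \<Rightarrow> 'a set \<Rightarrow> real" where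
  "set_dist d A B = Inf {d a b |a b. a \<in> A \<and> b \<in> B}"

definition Hausdorff_dist :: "('a \<Rightarrow> 'a \<Rightarrow> real) \<Rightarrow> 'a set \<Rightarrow> 'a set \<Rightarrow> real" where
  "Hausdorff_dist d A B =
     max (SUP a\<in>A. set_dist d {a} B) (SUP b\<in>B. set_dist d A {b})"

text \<open>A specification is encoded by its length \<open>n\<close>, its points \<open>x\<close> and its time windows
  \<open>k\<close>, \<open>l\<close>, all indexed by \<open>1, \<dots>, n\<close>; other indices are irrelevant.\<close>

definition spaced_specification ::
  "'a set \<Rightarrow> nat \<Rightarrow> nat \<Rightarrow> (nat \<Rightarrow> 'a) \<Rightarrow> (nat \<Rightarrow> nat) \<Rightarrow> (nat \<Rightarrow> nat) \<Rightarrow> bool" where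
  "spaced_specification X N n x k l \<longleftrightarrow>
     1 \<le> n \<and> (\<forall>j\<in>{1..n}. x j \<in> X \<and> k j \<le> l j) \<and>
     (\<forall>j\<in>{1..<n}. int (k (j + 1)) - int (l j) \<ge> int N)"

definition specification_property ::
  "'a set \<Rightarrow> ('a \<Rightarrow> 'a \<Rightarrow> real) \<Rightarrow> ('a \<Rightarrow> 'a) \<Rightarrow> bool" where
  "specification_property X d f \<longleftrightarrow>
     (\<forall>\<epsilon>>0. \<exists>N>0. \<forall>n x k l. spaced_specification X N n x k l \<longrightarrow>
        (\<exists>y\<in>X. \<forall>i\<in>{1..n}. \<forall>j\<in>{k i..l i}. d ((f ^^ j) y) ((f ^^ j) (x i)) \<le> \<epsilon>))"

definition traced ::
  "('a \<Rightarrow> 'a \<Rightarrow> real) \<Rightarrow> ('a \<times> 'a) set \<Rightarrow> real \<Rightarrow>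
   nat \<Rightarrow> (nat \<Rightarrow> 'a) \<Rightarrow> (nat \<Rightarrow> nat) \<Rightarrow> (nat \<Rightarrow> nat) \<Rightarrow> 'a \<Rightarrow> bool" where
  "traced d F \<epsilon> n x k l y \<longleftrightarrow>
     (\<forall>i\<in>{1..n}. \<forall>j\<in>{k i..l i}.
        iter F j y \<noteq> {} \<and> iter F j (x i) \<noteq> {} \<and>
        set_dist d (iter F j y) (iter F j (x i)) \<le> \<epsilon>)"

definition Hausdorff_traced ::
  "('a \<Rightarrow> 'a \<Rightarrow> real) \<Rightarrow> ('a \<times> 'a) set \<Rightarrow> real \<Rightarrow>
   nat \<Rightarrow> (nat \<Rightarrow> 'a) \<Rightarrow> (nat \<Rightarrow> nat) \<Rightarrow> (nat \<Rightarrow> nat) \<Rightarrow> 'a \<Rightarrow> bool" where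
  "Hausdorff_traced d F \<epsilon> n x k l y \<longleftrightarrow>
     (\<forall>i\<in>{1..n}. \<forall>j\<in>{k i..l i}.
        iter F j y \<noteq> {} \<and> iter F j (x i) \<noteq> {} \<and>
        Hausdorff_dist d (iter F j y) (iter F j (x i)) \<le> \<epsilon>)"

type_synonym 'a CR_property = "'a set \<Rightarrow> ('a \<Rightarrow> 'a \<Rightarrow> real) \<Rightarrow> ('a \<times> 'a) set \<Rightarrow> bool"
type_synonym 'a DS_property = "'a set \<Rightarrow> ('a \<Rightarrow> 'a \<Rightarrow> real) \<Rightarrow> ('a \<Rightarrow> 'a) \<Rightarrow> bool"

definition SP :: "'a CR_property" where
  "SP X d F \<longleftrightarrow>
     (\<forall>\<epsilon>>0. \<exists>N>0. \<forall>n x k l. spaced_specification X N n x k l \<longrightarrow>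
        (\<exists>y\<in>X. traced d F \<epsilon> n x k l y))"

definition HSP :: "'a CR_property" where
  "HSP X d F \<longleftrightarrow>
     (\<forall>\<epsilon>>0. \<exists>N>0. \<forall>n x k l. spaced_specification X N n x k l \<longrightarrow>
        (\<exists>y\<in>X. Hausdorff_traced d F \<epsilon> n x k l y))"

text \<open>The two arguments are the instances of one polymorphic property at two carrier types,
  so that conjugacies between systems of different types are covered.\<close>

definition CR_dynamical_property :: "'a CR_property \<Rightarrow> 'b CR_property \<Rightarrow> bool" where
  "CR_dynamical_property P Q \<longleftrightarrow>
     (\<forall>X d F Y e G. CR_system X d F \<and> CR_system Y e G \<and> CR_conjugate X d F Y e G \<longrightarrow>
        (P X d F \<longleftrightarrow> Q Y e G))"

definition generalizes :: "'a CR_property \<Rightarrow> 'a DS_property \<Rightarrow> bool" where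
  "generalizes P R \<longleftrightarrow>
     (\<forall>X d f. dynamical_system X d f \<longrightarrow> (P X d (graph_on X f) \<longleftrightarrow> R X d f))"

text \<open>The space of forward orbits, with indices starting at \<open>0\<close>, and its shift map.\<close>

definition orbit_space :: "'a set \<Rightarrow> ('a \<Rightarrow> 'a \<Rightarrow> real) \<Rightarrow> ('a \<times> 'a) set \<Rightarrow> (nat \<Rightarrow> 'a) topology" where
  "orbit_space Z d F =
     subtopology (product_topology (\<lambda>_. Metric_space.mtopology Z d) UNIV)
       {x. (\<forall>i. x i \<in> Z) \<and> (\<forall>i. (x i, x (Suc i)) \<in> F)}"

definition shift :: "(nat \<Rightarrow> 'a) \<Rightarrow> nat \<Rightarrow> 'a" where
  "shift x = (\<lambda>i. x (Suc i))"

text \<open>The definition of \<open>Power\<close> quantifies over all CR-dynamical systems. Letting their carriers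
  be subsets of \<^typ>\<open>nat \<Rightarrow> real\<close>, with arbitrary metrics, loses nothing: by the following lemma
  every compact metric space is isometric to one of this form (transport the metric
  along the injection).\<close>

lemma compact_metric_inj_on:
  assumes "compact_metric X d"
  shows "\<exists>\<phi> :: 'a \<Rightarrow> nat \<Rightarrow> real. inj_on \<phi> X"
proof -
  interpret Metric_space X d
    using assms by (simp add: compact_metric_def)
  have "mtotally_bounded X"
    using assms compact_space_eq_mcomplete_mtotally_bounded by (simp add: compact_metric_def)
  then have "\<forall>m::nat. \<exists>K. finite K \<and> K \<subseteq> X \<and> X \<subseteq> (\<Union>x\<in>K. mball x (1 / real (Suc m)))"
    unfolding mtotally_bounded_def by simp
  then obtain K where K: "\<And>m. finite (K m)" "\<And>m. K m \<subseteq> X"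
      "\<And>m::nat. X \<subseteq> (\<Union>x\<in>K m. mball x (1 / real (Suc m)))"
    by metis
  define D where "D = (\<Union>m. K m)"
  have "countable D"
    unfolding D_def using K(1) by (simp add: countable_finite)
  moreover have "D \<noteq> {}"
    using K(3)[of 0] assms by (auto simp: D_def compact_metric_def)
  ultimately have rng: "range (from_nat_into D) = D"
    by (rule range_from_nat_into[rotated])
  have "x = y"
    if x: "x \<in> X" and y: "y \<in> X"
      and eq: "(\<lambda>n. d (from_nat_into D n) x) = (\<lambda>n. d (from_nat_into D n) y)" for x y
  proof (rule ccontr)
    assume "x \<noteq> y"
    then have "d x y > 0"
      using x y by simp
    then obtain m where m: "1 / real (Suc m) < d x y / 2"
      using reals_Archimedean[of "d x y / 2"] by (auto simp: inverse_eq_divide)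
    obtain q where q: "q \<in> K m" "d q x < 1 / real (Suc m)"
      using K(3)[of m] x by auto
    then have "q \<in> range (from_nat_into D)"
      using rng by (auto simp: D_def)
    then have "d q y = d q x"
      using eq by (metis imageE)
    moreover have "d x y \<le> d q x + d q y"
      using triangle[of x q y] commute[of x q] K(2) q x y by auto
    ultimately show False
      using q m by simp
  qed
  then show ?thesis
    by (intro exI[of _ "\<lambda>x n. d (from_nat_into D n) x"] inj_onI) blast
qed

definition Power :: "(nat \<Rightarrow> real) CR_property \<Rightarrow> 'a DS_property" where
  "Power P X d f \<longleftrightarrow>
     (\<exists>Z e F. CR_system Z e F \<and> P Z e F \<and>
        conjugate (Metric_space.mtopology X d) f (orbit_space Z e F) shift)"

end

theory Submission
  imports Defs
begin

text \<open>Both properties bound a distance between iterates. A homeomorphism of compact metric spaces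
  is uniformly continuous, hence uniformly continuous for \<^const>\<open>set_dist\<close> and
  \<^const>\<open>Hausdorff_dist\<close> as well, and it intertwines the iterates; this gives invariance under
  conjugacy. On a graph all iterates are singletons, where both distances reduce to the metric.
  Finally, a system \<open>(X, f)\<close> is conjugate to the shift on the orbit space of its own graph, so
  a property that generalizes specification passes from \<open>(X, f)\<close> to a witness of \<^const>\<open>Power\<close>.\<close>

section \<open>Uniform continuity of maps on compact metric spaces\<close>

text \<open>The preimages of balls of radius \<open>\<epsilon>/2\<close> form an open cover of the
  compact space \<open>X\<close>. For a Lebesgue number \<open>\<delta>\<close> of this cover, two
  points closer than \<open>\<delta>\<close> lie in one preimage, so both of their images are within
  \<open>\<epsilon>/2\<close> of one centre.\<close>

lemma compact_metric_uniformly_continuous: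
  assumes X: "compact_metric X d" and Y: "Metric_space Y e"
    and f: "continuous_map (Metric_space.mtopology X d) (Metric_space.mtopology Y e) f"
    and "\<epsilon> > 0"
  obtains \<delta> where "\<delta> > 0" "\<And>x y. \<lbrakk>x \<in> X; y \<in> X; d x y < \<delta>\<rbrakk> \<Longrightarrow> e (f x) (f y) < \<epsilon>"
proof -
  interpret X: Metric_space X d using X by (simp add: compact_metric_def)
  interpret Y: Metric_space Y e by (fact Y)
  define U where "U z = {x \<in> topspace X.mtopology. f x \<in> Y.mball z (\<epsilon>/2)}" for z
  have op: "openin X.mtopology (U z)" for z
    unfolding U_def using openin_continuous_map_preimage[OF f Y.openin_mball] .
  have fX: "f x \<in> Y" if "x \<in> X" for x
    using f that by (metis Y.topspace_mtopology X.topspace_mtopology continuous_map_def PiE)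
  have cover: "X \<subseteq> \<Union>(U ` Y)"
    using fX \<open>\<epsilon> > 0\<close> by (force simp: U_def)
  have "compactin X.mtopology X"
    using X by (simp add: compact_metric_def compact_space_def)
  then obtain \<delta> where \<delta>: "\<delta> > 0" "\<And>x. x \<in> X \<Longrightarrow> \<exists>V\<in>U ` Y. X.mball x \<delta> \<subseteq> V"
    using X.lebesgue_number[OF _ cover] op by blast
  show thesis
  proof (rule that[OF \<delta>(1)])
    fix x y assume xy: "x \<in> X" "y \<in> X" "d x y < \<delta>"
    then obtain z where z: "z \<in> Y" "X.mball x \<delta> \<subseteq> U z" using \<delta>(2) by blast
    have "x \<in> U z" "y \<in> U z" using z(2) xy \<delta>(1) by auto
    then have "e z (f x) < \<epsilon>/2" "e z (f y) < \<epsilon>/2" by (auto simp: U_def)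
    then show "e (f x) (f y) < \<epsilon>"
      using Y.triangle[OF fX[OF xy(1)] z(1) fX[OF xy(2)]] Y.commute[of z "f x"] by linarith
  qed
qed

section \<open>Distances between sets\<close>

lemma set_dist_singleton [simp]: "set_dist d {a} {b} = d a b"
  by (simp add: set_dist_def)

lemma Hausdorff_dist_singleton [simp]: "Hausdorff_dist d {a} {b} = d a b"
  by (simp add: Hausdorff_dist_def)

context Metric_space
begin

lemma set_dist_le:
  assumes "a \<in> A" "b \<in> B" "d a b \<le> r"
  shows "set_dist d A B \<le> r"
proof -
  have "set_dist d A B \<le> d a b"
    unfolding set_dist_def by (rule cInf_lower) (use assms in \<open>auto intro!: bdd_belowI[of _ 0]\<close>)
  then show ?thesis using assms(3) by simp
qed

text \<open>An infimum need not be attained, but a strict bound on it is always realized by an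
  actual pair of points.\<close>

lemma set_dist_lessE:
  assumes "set_dist d A B < r" "A \<noteq> {}" "B \<noteq> {}"
  obtains a b where "a \<in> A" "b \<in> B" "d a b < r"
proof -
  have "{d a b |a b. a \<in> A \<and> b \<in> B} \<noteq> {}" using assms by auto
  from cInf_lessD[OF this] show thesis
    using assms(1) that by (auto simp: set_dist_def)
qed

lemma Hausdorff_dist_le:
  assumes "A \<noteq> {}" "B \<noteq> {}" "\<forall>a\<in>A. \<exists>b\<in>B. d a b \<le> r" "\<forall>b\<in>B. \<exists>a\<in>A. d a b \<le> r"
  shows "Hausdorff_dist d A B \<le> r"
  unfolding Hausdorff_dist_def
  by (intro max.boundedI cSUP_least) (use assms in \<open>auto intro: set_dist_le\<close>)

text \<open>Boundedness of the space makes both suprema range over sets that are bounded above, so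
  the distance from each single point to the other set is at most the Hausdorff distance. The strict
  bound then yields a point that realizes it.\<close>

lemma Hausdorff_dist_lessD:
  assumes "Hausdorff_dist d A B < r" "A \<noteq> {}" "B \<noteq> {}" "A \<subseteq> M" "B \<subseteq> M" "mbounded M"
  shows "\<forall>a\<in>A. \<exists>b\<in>B. d a b < r" "\<forall>b\<in>B. \<exists>a\<in>A. d a b < r"
proof -
  obtain C where C: "\<And>x y. \<lbrakk>x \<in> M; y \<in> M\<rbrakk> \<Longrightarrow> d x y \<le> C"
    using assms(6) by (auto simp: mbounded_alt)
  have bdd: "bdd_above ((\<lambda>a. set_dist d {a} B) ` A)" "bdd_above ((\<lambda>b. set_dist d A {b}) ` B)"
    using assms by (auto intro!: bdd_aboveI[of _ C] C set_dist_le)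
  have "set_dist d {a} B < r" if "a \<in> A" for a
    using cSUP_upper[OF that bdd(1)] assms(1) by (simp add: Hausdorff_dist_def)
  then show "\<forall>a\<in>A. \<exists>b\<in>B. d a b < r"
    using assms(3) by (metis set_dist_lessE insert_not_empty singletonD)
  have "set_dist d A {b} < r" if "b \<in> B" for b
    using cSUP_upper[OF that bdd(2)] assms(1) by (simp add: Hausdorff_dist_def)
  then show "\<forall>b\<in>B. \<exists>a\<in>A. d a b < r"
    using assms(2) by (metis set_dist_lessE insert_not_empty singletonD)
qed

end

lemma compact_metric_mbounded:
  assumes "compact_metric X d"
  shows "Metric_space.mbounded X d X"
proof -
  interpret Metric_space X d using assms by (simp add: compact_metric_def)
  show ?thesis
    using assms compactin_imp_mbounded by (simp add: compact_metric_def compact_space_def)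
qed

section \<open>Uniform continuity with respect to distances between sets\<close>

text \<open>\<open>D\<close> and \<open>E\<close> are meant to be one construction, such as
  \<open>set_dist\<close>, at two carrier types; a parameter has a single type within a statement,
  so it is passed twice.\<close>

definition unif_continuous_sets ::
  "(('a \<Rightarrow> 'a \<Rightarrow> real) \<Rightarrow> 'a set \<Rightarrow> 'a set \<Rightarrow> real) \<Rightarrow>
   (('b \<Rightarrow> 'b \<Rightarrow> real) \<Rightarrow> 'b set \<Rightarrow> 'b set \<Rightarrow> real) \<Rightarrow>
   'a set \<Rightarrow> ('a \<Rightarrow> 'a \<Rightarrow> real) \<Rightarrow> ('b \<Rightarrow> 'b \<Rightarrow> real) \<Rightarrow> ('a \<Rightarrow> 'b) \<Rightarrow> bool" where
  "unif_continuous_sets D E X d e \<phi> \<longleftrightarrow>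
     (\<forall>\<epsilon>>0. \<exists>\<delta>>0. \<forall>A B. A \<noteq> {} \<and> B \<noteq> {} \<and> A \<subseteq> X \<and> B \<subseteq> X \<and> D d A B \<le> \<delta> \<longrightarrow>
        E e (\<phi> ` A) (\<phi> ` B) \<le> \<epsilon>)"

text \<open>One modulus of continuity of \<open>\<phi>\<close> serves both distances:
  \<open>set_dist\<close> asks for one pair of close points and \<open>Hausdorff_dist\<close> for a
  close partner of every point, and \<open>\<phi>\<close> keeps close points close.\<close>

lemma
  assumes X: "compact_metric X d" and Y: "Metric_space Y e"
    and \<phi>: "continuous_map (Metric_space.mtopology X d) (Metric_space.mtopology Y e) \<phi>"
  shows unif_continuous_set_dist: "unif_continuous_sets set_dist set_dist X d e \<phi>"
    and unif_continuous_Hausdorff_dist: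
      "unif_continuous_sets Hausdorff_dist Hausdorff_dist X d e \<phi>"
proof -
  interpret X: Metric_space X d using X by (simp add: compact_metric_def)
  interpret Y: Metric_space Y e by (fact Y)
  have "\<exists>\<delta>>0. \<forall>A B. A \<noteq> {} \<and> B \<noteq> {} \<and> A \<subseteq> X \<and> B \<subseteq> X \<longrightarrow>
      (set_dist d A B \<le> \<delta> \<longrightarrow> set_dist e (\<phi> ` A) (\<phi> ` B) \<le> \<epsilon>) \<and>
      (Hausdorff_dist d A B \<le> \<delta> \<longrightarrow> Hausdorff_dist e (\<phi> ` A) (\<phi> ` B) \<le> \<epsilon>)"
    if "\<epsilon> > 0" for \<epsilon>
  proof -
    obtain \<delta> where \<delta>: "\<delta> > 0" "\<And>x y. \<lbrakk>x \<in> X; y \<in> X; d x y < \<delta>\<rbrakk> \<Longrightarrow> e (\<phi> x) (\<phi> y) < \<epsilon>"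
      using compact_metric_uniformly_continuous[OF X Y \<phi> \<open>\<epsilon> > 0\<close>] by metis
    \<comment> \<open>Halving \<open>\<delta>\<close> turns the weak bound on the distance into the
      strict bound \<open>< \<delta>\<close> from which actual points can be extracted.\<close>
    have "set_dist e (\<phi> ` A) (\<phi> ` B) \<le> \<epsilon>"
      if AB: "A \<noteq> {}" "B \<noteq> {}" "A \<subseteq> X" "B \<subseteq> X" and le: "set_dist d A B \<le> \<delta>/2" for A B
    proof -
      obtain a b where "a \<in> A" "b \<in> B" "d a b < \<delta>"
        using X.set_dist_lessE[of A B \<delta>] AB le \<delta>(1) by auto
      moreover from this have "e (\<phi> a) (\<phi> b) < \<epsilon>"
        using \<delta>(2) AB by blast
      ultimately show ?thesis
        by (intro Y.set_dist_le[of "\<phi> a" _ "\<phi> b"]) auto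
    qed
    moreover have "Hausdorff_dist e (\<phi> ` A) (\<phi> ` B) \<le> \<epsilon>"
      if AB: "A \<noteq> {}" "B \<noteq> {}" "A \<subseteq> X" "B \<subseteq> X" and le: "Hausdorff_dist d A B \<le> \<delta>/2" for A B
    proof -
      have lt: "Hausdorff_dist d A B < \<delta>" using le \<delta>(1) by simp
      note close = X.Hausdorff_dist_lessD[OF lt AB compact_metric_mbounded[OF X]]
      show ?thesis
      proof (rule Y.Hausdorff_dist_le)
        show "\<forall>a\<in>\<phi> ` A. \<exists>b\<in>\<phi> ` B. e a b \<le> \<epsilon>" "\<forall>b\<in>\<phi> ` B. \<exists>a\<in>\<phi> ` A. e a b \<le> \<epsilon>"
          using close AB \<delta>(2) by (simp, meson less_imp_le subsetD)+
      qed (use AB in auto)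
    qed
    ultimately show ?thesis
      using \<delta>(1) by (intro exI[of _ "\<delta>/2"]) auto
  qed
  then show "unif_continuous_sets set_dist set_dist X d e \<phi>"
    "unif_continuous_sets Hausdorff_dist Hausdorff_dist X d e \<phi>"
    unfolding unif_continuous_sets_def by meson+
qed

section \<open>Invariance under conjugacy\<close>

text \<open>The common form of \<open>SP\<close> and \<open>HSP\<close>: with the distance as a
  parameter, invariance and generalization need only one proof each.\<close>

definition tracing_property ::
  "(('a \<Rightarrow> 'a \<Rightarrow> real) \<Rightarrow> 'a set \<Rightarrow> 'a set \<Rightarrow> real) \<Rightarrow> 'a CR_property" where
  "tracing_property D X d F \<longleftrightarrow>
     (\<forall>\<epsilon>>0. \<exists>N>0. \<forall>n x k l. spaced_specification X N n x k l \<longrightarrow>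
        (\<exists>y\<in>X. \<forall>i\<in>{1..n}. \<forall>j\<in>{k i..l i}.
           iter F j y \<noteq> {} \<and> iter F j (x i) \<noteq> {} \<and> D d (iter F j y) (iter F j (x i)) \<le> \<epsilon>))"

lemma SP_eq_tracing_property: "SP = tracing_property set_dist"
  by (simp add: fun_eq_iff SP_def traced_def tracing_property_def)

lemma HSP_eq_tracing_property: "HSP = tracing_property Hausdorff_dist"
  by (simp add: fun_eq_iff HSP_def Hausdorff_traced_def tracing_property_def)

lemma CR_system_subset: "CR_system X d F \<Longrightarrow> F \<subseteq> X \<times> X"
  by (auto simp: CR_system_def compact_metric_def Metric_space.topspace_mtopology
      dest!: closedin_subset)

lemma iter_subset: "\<lbrakk>F \<subseteq> X \<times> X; x \<in> X\<rbrakk> \<Longrightarrow> iter F k x \<subseteq> X"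
  by (cases k) auto

text \<open>Surjectivity of \<open>\<phi>\<close> drives the induction: every
  \<open>G\<close>-successor of \<open>\<phi> a\<close> lies in \<open>Y\<close>, hence has the form
  \<open>\<phi> b\<close> with \<open>b\<close> in \<open>X\<close>, and the conjugacy condition
  turns that edge into an edge of \<open>F\<close> from \<open>a\<close> to
  \<open>b\<close>.\<close>

lemma iter_conjugate:
  assumes "F \<subseteq> X \<times> X" "G \<subseteq> Y \<times> Y" "\<phi> ` X = Y"
    and conj: "\<forall>x\<in>X. \<forall>y\<in>X. (x, y) \<in> F \<longleftrightarrow> (\<phi> x, \<phi> y) \<in> G"
    and x: "x \<in> X"
  shows "iter G k (\<phi> x) = \<phi> ` iter F k x"
proof (induction k)
  case (Suc k)
  have "G `` (\<phi> ` A) = \<phi> ` (F `` A)" if "A \<subseteq> X" for A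
  proof (intro equalityI subsetI)
    fix v assume "v \<in> G `` (\<phi> ` A)"
    then obtain a where a: "a \<in> A" "(\<phi> a, v) \<in> G" by blast
    moreover obtain b where "b \<in> X" "v = \<phi> b" using a assms(2,3) by blast
    ultimately show "v \<in> \<phi> ` (F `` A)" using conj that by blast
  next
    fix v assume "v \<in> \<phi> ` (F `` A)"
    then show "v \<in> G `` (\<phi> ` A)" using conj that assms(1) by blast
  qed
  then show ?case using Suc iter_subset[OF assms(1) x] by simp
qed simp

text \<open>A specification in \<open>Y\<close> is pulled back to \<open>X\<close>, traced there up
  to the \<open>\<delta>\<close> that uniform continuity assigns to \<open>\<epsilon>\<close>, and
  the tracing point is pushed forward by \<open>\<phi>\<close>. The spacing \<open>N\<close> found
  for \<open>\<delta>\<close> in \<open>X\<close> therefore serves \<open>\<epsilon>\<close> in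
  \<open>Y\<close>.\<close>

lemma tracing_property_conjugate:
  assumes FG: "F \<subseteq> X \<times> X" "G \<subseteq> Y \<times> Y" and \<phi>: "\<phi> ` X = Y"
    and conj: "\<forall>x\<in>X. \<forall>y\<in>X. (x, y) \<in> F \<longleftrightarrow> (\<phi> x, \<phi> y) \<in> G"
    and uc: "unif_continuous_sets D E X d e \<phi>"
    and tr: "tracing_property D X d F"
  shows "tracing_property E Y e G"
  unfolding tracing_property_def
proof (intro allI impI)
  note iter = iter_conjugate[OF FG \<phi> conj]
  fix \<epsilon> :: real assume "\<epsilon> > 0"
  obtain \<delta> where "\<delta> > 0" and \<delta>: "\<forall>A B. A \<noteq> {} \<and> B \<noteq> {} \<and> A \<subseteq> X \<and> B \<subseteq> X \<and> D d A B \<le> \<delta> \<longrightarrow>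
      E e (\<phi> ` A) (\<phi> ` B) \<le> \<epsilon>"
    using uc[unfolded unif_continuous_sets_def, THEN spec, THEN mp, OF \<open>\<epsilon> > 0\<close>] by (elim exE conjE)
  obtain N where "N > 0" and N: "\<forall>n x k l. spaced_specification X N n x k l \<longrightarrow>
      (\<exists>y\<in>X. \<forall>i\<in>{1..n}. \<forall>j\<in>{k i..l i}.
         iter F j y \<noteq> {} \<and> iter F j (x i) \<noteq> {} \<and> D d (iter F j y) (iter F j (x i)) \<le> \<delta>)"
    using tr[unfolded tracing_property_def, THEN spec, THEN mp, OF \<open>\<delta> > 0\<close>] by (elim exE conjE)
  have "\<forall>n x k l. spaced_specification Y N n x k l \<longrightarrow>
      (\<exists>y\<in>Y. \<forall>i\<in>{1..n}. \<forall>j\<in>{k i..l i}.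
         iter G j y \<noteq> {} \<and> iter G j (x i) \<noteq> {} \<and> E e (iter G j y) (iter G j (x i)) \<le> \<epsilon>)"
  proof (intro allI impI)
    fix n x k l assume spaced: "spaced_specification Y N n x k l"
    \<comment> \<open>Only the indices in \<open>{1..n}\<close> are known to give points of
      \<open>Y\<close>, so \<open>x'\<close> is controlled only there.\<close>
    define x' where "x' i = inv_into X \<phi> (x i)" for i
    have x': "x' i \<in> X" "\<phi> (x' i) = x i" if "i \<in> {1..n}" for i
    proof -
      have "x i \<in> \<phi> ` X"
        using spaced that unfolding spaced_specification_def \<phi> by blast
      then show "x' i \<in> X" "\<phi> (x' i) = x i"
        unfolding x'_def by (rule inv_into_into, rule f_inv_into_f)
    qed
    have spaced': "spaced_specification X N n x' k l"
      using spaced x'(1) unfolding spaced_specification_def by blast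
    obtain y where y: "y \<in> X" and tr: "\<forall>i\<in>{1..n}. \<forall>j\<in>{k i..l i}.
        iter F j y \<noteq> {} \<and> iter F j (x' i) \<noteq> {} \<and> D d (iter F j y) (iter F j (x' i)) \<le> \<delta>"
      using N[rule_format, OF spaced'] by blast
    show "\<exists>y\<in>Y. \<forall>i\<in>{1..n}. \<forall>j\<in>{k i..l i}.
         iter G j y \<noteq> {} \<and> iter G j (x i) \<noteq> {} \<and> E e (iter G j y) (iter G j (x i)) \<le> \<epsilon>"
    proof (intro bexI[of _ "\<phi> y"] ballI)
      fix i j assume ij: "i \<in> {1..n}" "j \<in> {k i..l i}"
      have eq: "iter G j (x i) = \<phi> ` iter F j (x' i)" "iter G j (\<phi> y) = \<phi> ` iter F j y"
        using iter[OF x'(1)[OF ij(1)]] iter[OF y] by (simp_all only: x'(2)[OF ij(1)])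
      note tr' = tr[THEN bspec, THEN bspec, OF ij]
      have "E e (\<phi> ` iter F j y) (\<phi> ` iter F j (x' i)) \<le> \<epsilon>"
        using tr' iter_subset[OF FG(1) y] iter_subset[OF FG(1) x'(1)[OF ij(1)]]
        by (intro \<delta>[rule_format] conjI) blast+
      then show "iter G j (\<phi> y) \<noteq> {} \<and> iter G j (x i) \<noteq> {} \<and>
          E e (iter G j (\<phi> y)) (iter G j (x i)) \<le> \<epsilon>"
        using tr' by (simp add: eq)
    qed (use y \<phi> in auto)
  qed
  with \<open>N > 0\<close> show "\<exists>N>0. \<forall>n x k l. spaced_specification Y N n x k l \<longrightarrow>
      (\<exists>y\<in>Y. \<forall>i\<in>{1..n}. \<forall>j\<in>{k i..l i}.
         iter G j y \<noteq> {} \<and> iter G j (x i) \<noteq> {} \<and> E e (iter G j y) (iter G j (x i)) \<le> \<epsilon>)"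
    by (intro exI conjI)
qed

text \<open>The one-directional transfer is applied to the homeomorphism and to its inverse. Since
  \<open>D\<close> and \<open>E\<close> have different types, uniform continuity is assumed
  separately for each direction.\<close>

lemma CR_dynamical_property_tracing_property:
  fixes D :: "('a \<Rightarrow> 'a \<Rightarrow> real) \<Rightarrow> 'a set \<Rightarrow> 'a set \<Rightarrow> real"
    and E :: "('b \<Rightarrow> 'b \<Rightarrow> real) \<Rightarrow> 'b set \<Rightarrow> 'b set \<Rightarrow> real"
  assumes DE: "\<And>X d Y e \<phi>. \<lbrakk>compact_metric X d; Metric_space Y e;
        continuous_map (Metric_space.mtopology X d) (Metric_space.mtopology Y e) \<phi>\<rbrakk> \<Longrightarrow>
        unif_continuous_sets D E X d e \<phi>"
    and ED: "\<And>X d Y e \<phi>. \<lbrakk>compact_metric Y e; Metric_space X d;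
        continuous_map (Metric_space.mtopology Y e) (Metric_space.mtopology X d) \<phi>\<rbrakk> \<Longrightarrow>
        unif_continuous_sets E D Y e d \<phi>"
  shows "CR_dynamical_property (tracing_property D) (tracing_property E)"
  unfolding CR_dynamical_property_def
proof (intro allI impI, elim conjE)
  fix X :: "'a set" and d F and Y :: "'b set" and e G
  assume F: "CR_system X d F" and G: "CR_system Y e G" and conj: "CR_conjugate X d F Y e G"
  have X: "compact_metric X d" and Y: "compact_metric Y e"
    using F G by (auto simp: CR_system_def)
  interpret X: Metric_space X d using X by (simp add: compact_metric_def)
  interpret Y: Metric_space Y e using Y by (simp add: compact_metric_def)
  obtain \<phi> \<psi> where maps: "homeomorphic_maps X.mtopology Y.mtopology \<phi> \<psi>"
    and \<phi>: "\<forall>x\<in>X. \<forall>y\<in>X. (x, y) \<in> F \<longleftrightarrow> (\<phi> x, \<phi> y) \<in> G"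
    using conj unfolding CR_conjugate_def homeomorphic_map_maps by blast
  have cont: "continuous_map X.mtopology Y.mtopology \<phi>" "continuous_map Y.mtopology X.mtopology \<psi>"
    and inv: "\<And>x. x \<in> X \<Longrightarrow> \<psi> (\<phi> x) = x" "\<And>y. y \<in> Y \<Longrightarrow> \<phi> (\<psi> y) = y"
    using maps by (auto simp: homeomorphic_maps_def)
  have into: "\<phi> ` X \<subseteq> Y" "\<psi> ` Y \<subseteq> X"
    using cont by (force dest: continuous_map_image_subset_topspace)+
  have img: "\<phi> ` X = Y" "\<psi> ` Y = X"
    using into inv by force+
  have \<psi>: "\<forall>x\<in>Y. \<forall>y\<in>Y. (x, y) \<in> G \<longleftrightarrow> (\<psi> x, \<psi> y) \<in> F"
    using \<phi> inv into by (metis image_subset_iff)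
  note sub = CR_system_subset[OF F] CR_system_subset[OF G]
  show "tracing_property D X d F \<longleftrightarrow> tracing_property E Y e G"
    using tracing_property_conjugate[OF sub img(1) \<phi> DE[OF X Y.Metric_space_axioms cont(1)]]
      tracing_property_conjugate[OF sub(2,1) img(2) \<psi> ED[OF Y X.Metric_space_axioms cont(2)]]
    by blast
qed

section \<open>Graphs of continuous maps as CR-dynamical systems\<close>

lemma funpow_closed:
  assumes "f ` X \<subseteq> X" "x \<in> X"
  shows "(f ^^ k) x \<in> X"
  using assms by (induction k) auto

lemma iter_graph_on:
  assumes "f ` X \<subseteq> X" "x \<in> X"
  shows "iter (graph_on X f) k x = {(f ^^ k) x}"
  by (induction k) (use funpow_closed[OF assms] in \<open>auto simp: graph_on_def\<close>)

lemma dynamical_system_image: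
  assumes "dynamical_system X d f"
  shows "f ` X \<subseteq> X"
proof -
  interpret Metric_space X d using assms by (simp add: dynamical_system_def compact_metric_def)
  show ?thesis
    using assms continuous_map_image_subset_topspace[of mtopology mtopology f]
    by (simp add: dynamical_system_def)
qed

text \<open>Iterates along a graph are singletons, so they are never empty and \<open>D\<close>
  reduces to the metric; the two definitions then agree clause by clause.\<close>

lemma generalizes_tracing_property:
  fixes D :: "('a \<Rightarrow> 'a \<Rightarrow> real) \<Rightarrow> 'a set \<Rightarrow> 'a set \<Rightarrow> real"
  assumes "\<And>d a b. D d {a} {b} = d a b"
  shows "generalizes (tracing_property D) specification_property"
  unfolding generalizes_def
proof (intro allI impI)
  fix X :: "'a set" and d f assume ds: "dynamical_system X d f"
  note it = iter_graph_on[OF dynamical_system_image[OF ds]]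
  have "(iter (graph_on X f) j y \<noteq> {} \<and> iter (graph_on X f) j (x i) \<noteq> {} \<and>
         D d (iter (graph_on X f) j y) (iter (graph_on X f) j (x i)) \<le> \<epsilon>) \<longleftrightarrow>
        d ((f ^^ j) y) ((f ^^ j) (x i)) \<le> \<epsilon>"
    if "spaced_specification X N n x k l" "i \<in> {1..n}" "y \<in> X" for N n x k l i j y \<epsilon>
    using that by (auto simp: it assms spaced_specification_def)
  then show "tracing_property D X d (graph_on X f) \<longleftrightarrow> specification_property X d f"
    unfolding tracing_property_def specification_property_def
    by (intro all_cong1 imp_cong ex_cong1 conj_cong bex_cong ball_cong refl) blast
qed

text \<open>The graph is the set where the continuous maps \<open>f \<circ> fst\<close> and
  \<open>snd\<close> into a Hausdorff space coincide, hence it is closed.\<close>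

lemma CR_system_graph_on:
  assumes "dynamical_system X d f"
  shows "CR_system X d (graph_on X f)"
proof -
  interpret Metric_space X d using assms by (simp add: dynamical_system_def compact_metric_def)
  have f: "continuous_map mtopology mtopology f" using assms by (simp add: dynamical_system_def)
  have "closedin (prod_topology mtopology mtopology)
      {z \<in> topspace (prod_topology mtopology mtopology). (f \<circ> fst) z = snd z}"
    by (intro closedin_continuous_maps_eq[OF Hausdorff_space_mtopology]
        continuous_map_compose[OF continuous_map_fst f] continuous_map_snd)
  moreover have "{z \<in> topspace (prod_topology mtopology mtopology). (f \<circ> fst) z = snd z}
      = graph_on X f"
    using dynamical_system_image[OF assms] by (auto simp: graph_on_def)
  ultimately show ?thesis using assms by (simp add: CR_system_def dynamical_system_def)
qed

section \<open>Orbit spaces of graphs and \<open>Power\<close>\<close>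

text \<open>An orbit of a graph is determined by its initial point. Sending a point to its orbit is
  continuous because each coordinate is a power of \<open>f\<close>, and its inverse is the
  projection to coordinate \<open>0\<close>.\<close>

lemma conjugate_orbit_space_graph_on:
  assumes ds: "dynamical_system X d f"
  shows "conjugate (Metric_space.mtopology X d) f (orbit_space X d (graph_on X f)) shift"
proof -
  interpret Metric_space X d using ds by (simp add: dynamical_system_def compact_metric_def)
  have f: "continuous_map mtopology mtopology f" using ds by (simp add: dynamical_system_def)
  note X = funpow_closed[OF dynamical_system_image[OF ds]]
  define h where "h x = (\<lambda>i. (f ^^ i) x)" for x
  have pow: "continuous_map mtopology mtopology (f ^^ i)" for i
  proof (induction i)
    case (Suc i)
    then show ?case using continuous_map_compose[OF Suc f] by (simp add: o_def)
  qed simp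
  have orbit: "h (p 0) = p" if "\<forall>i. p i \<in> X \<and> (p i, p (Suc i)) \<in> graph_on X f" for p
  proof
    show "h (p 0) i = p i" for i
      using that by (induction i) (auto simp: h_def graph_on_def)
  qed
  have "homeomorphic_maps mtopology (orbit_space X d (graph_on X f)) h (\<lambda>p. p 0)"
    unfolding homeomorphic_maps_def orbit_space_def
  proof (intro conjI)
    show "continuous_map mtopology (subtopology (product_topology (\<lambda>_. mtopology) UNIV)
        {x. (\<forall>i. x i \<in> X) \<and> (\<forall>i. (x i, x (Suc i)) \<in> graph_on X f)}) h"
      unfolding continuous_map_in_subtopology continuous_map_componentwise_UNIV
      using pow X by (auto simp: h_def graph_on_def)
    show "continuous_map (subtopology (product_topology (\<lambda>_. mtopology) UNIV)
        {x. (\<forall>i. x i \<in> X) \<and> (\<forall>i. (x i, x (Suc i)) \<in> graph_on X f)}) mtopology (\<lambda>p. p 0)"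
      by (intro continuous_map_from_subtopology continuous_map_product_projection UNIV_I)
  qed (use orbit in \<open>auto simp: h_def\<close>)
  moreover have "h (f x) = shift (h x)" for x
    by (simp add: h_def shift_def funpow_swap1)
  ultimately show ?thesis
    unfolding conjugate_def homeomorphic_map_maps by blast
qed

lemma conjugate_trans:
  assumes "conjugate T f U g" "conjugate U g V h"
  shows "conjugate T f V h"
proof -
  obtain \<phi> \<psi> where \<phi>: "homeomorphic_map T U \<phi>" "\<forall>x\<in>topspace T. \<phi> (f x) = g (\<phi> x)"
    and \<psi>: "homeomorphic_map U V \<psi>" "\<forall>x\<in>topspace U. \<psi> (g x) = h (\<psi> x)"
    using assms unfolding conjugate_def by blast
  have "\<forall>x\<in>topspace T. \<phi> x \<in> topspace U"
    using homeomorphic_imp_surjective_map[OF \<phi>(1)] by blast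
  then show ?thesis
    unfolding conjugate_def
    using homeomorphic_map_compose[OF \<phi>(1) \<psi>(1)] \<phi>(2) \<psi>(2) by (intro exI[of _ "\<psi> \<circ> \<phi>"]) auto
qed

text \<open>The carriers in \<^const>\<open>Power\<close> lie in \<^typ>\<open>nat \<Rightarrow> real\<close>, so the graph of \<open>f\<close> is first
  replaced by an isometric copy there.\<close>

lemma dynamical_system_isometric_copy:
  fixes X :: "'a set"
  assumes ds: "dynamical_system X d f"
  obtains Z :: "(nat \<Rightarrow> real) set" and e g
  where "dynamical_system Z e g"
    and "conjugate (Metric_space.mtopology X d) f (Metric_space.mtopology Z e) g"
    and "CR_conjugate X d (graph_on X f) Z e (graph_on Z g)"
proof -
  have cm: "compact_metric X d" using ds by (simp add: dynamical_system_def)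
  interpret X: Metric_space X d using cm by (simp add: compact_metric_def)
  obtain \<phi> :: "'a \<Rightarrow> nat \<Rightarrow> real" where inj: "inj_on \<phi> X"
    using compact_metric_inj_on[OF cm] by blast
  define \<psi> where "\<psi> = inv_into X \<phi>"
  have \<psi>\<phi> [simp]: "\<psi> (\<phi> x) = x" if "x \<in> X" for x
    using that inj by (simp add: \<psi>_def)
  define Z where "Z = \<phi> ` X"
  \<comment> \<open>The metric is transported from \<open>X\<close>, which makes
    \<open>\<phi>\<close> an isometry onto \<open>Z\<close> by construction; it is not a restriction
    of some metric fixed on \<open>nat \<Rightarrow> real\<close>.\<close>
  define e where "e u v = d (\<psi> u) (\<psi> v)" for u v
  define g where "g = \<phi> \<circ> f \<circ> \<psi>"
  interpret Z: Metric_space Z e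
    by unfold_locales (auto simp: e_def Z_def X.commute X.triangle)
  interpret XZ: Metric_space12 X d Z e ..
  have hom: "homeomorphic_map X.mtopology Z.mtopology \<phi>"
    by (rule XZ.isometry_imp_homeomorphic_map) (auto simp: Z_def e_def)
  interpret ZX: Metric_space12 Z e X d ..
  have hom': "homeomorphic_map Z.mtopology X.mtopology \<psi>"
    by (rule ZX.isometry_imp_homeomorphic_map) (auto simp: Z_def e_def image_image)
  have f: "continuous_map X.mtopology X.mtopology f" using ds by (simp add: dynamical_system_def)
  note fX = dynamical_system_image[OF ds]
  have "compact_metric Z e"
    using cm homeomorphic_compact_space[OF homeomorphic_map_imp_homeomorphic_space[OF hom]]
    by (auto simp: compact_metric_def Z_def Z.Metric_space_axioms[unfolded Z_def])
  moreover have "continuous_map Z.mtopology Z.mtopology g"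
    unfolding g_def
    by (intro continuous_map_compose[OF homeomorphic_imp_continuous_map[OF hom']]
        continuous_map_compose[OF f] homeomorphic_imp_continuous_map[OF hom])
  ultimately have "dynamical_system Z e g" by (simp add: dynamical_system_def)
  moreover have "conjugate X.mtopology f Z.mtopology g"
    unfolding conjugate_def using hom by (intro exI[of _ \<phi>]) (auto simp: g_def)
  moreover have "CR_conjugate X d (graph_on X f) Z e (graph_on Z g)"
    unfolding CR_conjugate_def
    using hom fX inj by (intro exI[of _ \<phi>]) (auto simp: g_def graph_on_def Z_def inj_on_def)
  ultimately show thesis by (rule that)
qed

text \<open>The witness is the graph of the isometric copy \<open>g\<close>. Generalization gives
  \<open>P\<close> for the graph of \<open>f\<close>, invariance carries it to \<open>Q\<close> for
  the graph of \<open>g\<close>, and the shift on that graph's orbit space is conjugate to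
  \<open>g\<close>, hence to \<open>f\<close>.\<close>

lemma generalizes_imp_Power:
  assumes P: "CR_dynamical_property P Q" "generalizes P R"
    and ds: "dynamical_system X d f" and "R X d f"
  shows "Power Q X d f"
proof -
  obtain Z :: "(nat \<Rightarrow> real) set" and e g where Z: "dynamical_system Z e g"
      "conjugate (Metric_space.mtopology X d) f (Metric_space.mtopology Z e) g"
      "CR_conjugate X d (graph_on X f) Z e (graph_on Z g)"
    by (rule dynamical_system_isometric_copy[OF ds])
  have "P X d (graph_on X f)"
    using assms by (simp add: generalizes_def)
  then have "Q Z e (graph_on Z g)"
    using P(1) CR_system_graph_on[OF ds] CR_system_graph_on[OF Z(1)] Z(3)
    unfolding CR_dynamical_property_def by blast
  then show ?thesis
    unfolding Power_def
    using CR_system_graph_on[OF Z(1)]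
      conjugate_trans[OF Z(2) conjugate_orbit_space_graph_on[OF Z(1)]] by blast
qed

section \<open>Specialization to \<open>SP\<close> and \<open>HSP\<close>\<close>

lemma SP_conjugacy_invariant: "CR_dynamical_property (SP :: 'a CR_property) (SP :: 'b CR_property)"
  unfolding SP_eq_tracing_property
  by (intro CR_dynamical_property_tracing_property unif_continuous_set_dist)

lemma HSP_conjugacy_invariant:
  "CR_dynamical_property (HSP :: 'a CR_property) (HSP :: 'b CR_property)"
  unfolding HSP_eq_tracing_property
  by (intro CR_dynamical_property_tracing_property unif_continuous_Hausdorff_dist)

lemma SP_generalizes: "generalizes SP specification_property"
  unfolding SP_eq_tracing_property by (simp add: generalizes_tracing_property)

lemma HSP_generalizes: "generalizes HSP specification_property"
  unfolding HSP_eq_tracing_property by (simp add: generalizes_tracing_property)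

theorem theorem4p8:
  shows
    "(CR_dynamical_property (SP :: 'a CR_property) (SP :: 'b CR_property) \<and>
      generalizes (SP :: 'a CR_property) specification_property \<and>
      (\<forall>(X :: 'a set) d f. dynamical_system X d f \<longrightarrow>
         specification_property X d f \<longrightarrow> Power SP X d f)) \<and>
     (CR_dynamical_property (HSP :: 'a CR_property) (HSP :: 'b CR_property) \<and>
      generalizes (HSP :: 'a CR_property) specification_property \<and>
      (\<forall>(X :: 'a set) d f. dynamical_system X d f \<longrightarrow>
         specification_property X d f \<longrightarrow> Power HSP X d f))"
  \<comment> \<open>Invariance is used at two pairs of types: from \<open>'a\<close> to
    \<open>nat \<Rightarrow> real\<close> for the \<open>Power\<close> claims, and from
    \<open>'a\<close> to \<open>'b\<close> for the stated invariance.\<close>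
  using generalizes_imp_Power[OF SP_conjugacy_invariant SP_generalizes]
    generalizes_imp_Power[OF HSP_conjugacy_invariant HSP_generalizes]
    SP_conjugacy_invariant HSP_conjugacy_invariant SP_generalizes HSP_generalizes
  by blast

end
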